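(* Let $X$ be a real normed space, let $(u,f)$ be a norming pair and let $D_{u,f}:X\to[0,+\infty)$ be transversally coercive at $(u,f)$ with constant $c_{u,f}>0$. (i) For $\delta>0$, set $\varphi^a_{D,u,f,\delta}:=f-\delta^{-1}D_{u,f}$ and $C^a_D(u,f,\delta):=\{x\in X:\varphi^a_{D,u,f,\delta}(x)\ge0\}$. Then $C^a_D(u,f,\delta)$ is a closed cone, $u\in\operatorname{int}C^a_D(u,f,\delta)$, and for every $0<\varepsilon<1$, \[ 0<\delta<c_{u,f}\varepsilon\ \Longrightarrow\ C^a_D(u,f,\delta)\subset\operatorname{cone}B(u,\varepsilon). \] For such $\delta$ the cone is pointed and $\varphi^a_{D,u,f,\delta}$ is an adapted defining function for it at $u$. If $D_{u,f}$ is subadditive, then $\varphi^a_{D,u,f,\delta}$ is superlinear and $C^a_D(u,f,\delta)$ is convex. (ii) For $r>0$, set $\varphi^n_{D,u,f,r}(x):=\min\{f(x),\ \|x\|-r^{-1}D_{u,f}(x)\}$ and $C^{\rm n}_D(u,f,r):=\{x\in X:\varphi^n_{D,u,f,r}(x)\ge0\}$. Then $C^{\rm n}_D(u,f,r)$ is a closed cone, $u\in\operatorname{int}C^{\rm n}_D(u,f,r)$, and for every $0<\varepsilon<1$, \[ 0<r<\frac{c_{u,f}\,\varepsilon}{1+\varepsilon}\ \Longrightarrow\ C^{\rm n}_D(u,f,r)\subset\operatorname{cone}B(u,\varepsilon). \] For such $r$ the cone is pointed and $\varphi^n_{D,u,f,r}$ is an adapted defining function for it at $u$.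
   Context: $S_X$, $S_{X^*}$ are the unit spheres of $X$ and $X^*$, $B(x,r)=\{y\in X:\|y-x\|\le r\}$, $\operatorname{cone}(A)=\{ta:t\ge0,\ a\in A\}$. A nonempty set $C\subset X$ is a cone if $tC\subset C$ for every $t\ge 0$; all cones are assumed proper, i.e. $\{0_X\}\subsetneq C\subsetneq X$; a cone is pointed if $C\cap(-C)=\{0_X\}$. A norming pair is $(u,f)\in S_X\times S_{X^*}$ with $f(u)=1$; put $Q_{u,f}x:=x-f(x)u$. A continuous positively homogeneous mapping $D:X\to[0,+\infty)$ is transversally coercive at $(u,f)$ with constant $c>0$ if $D(u)=0$ and $D(x)\ge c\|Q_{u,f}x\|$ whenever $f(x)\ge0$. Positively homogeneous: $\varphi(tx)=t\varphi(x)$ for all $t\ge0$; subadditive: $p(x+y)\le p(x)+p(y)$; superlinear: positively homogeneous and $\varphi(x+y)\ge\varphi(x)+\varphi(y)$. An adapted defining function for a closed cone $C$ at $u\in S_X\cap\operatorname{int}C$ is a continuous positively homogeneous $\varphi:X\to\mathbb R$ with $C=\{\varphi\ge0\}$, $\varphi(u)=1$, and $\varphi(x)\le\|x\|$ for every $x\in X$. *)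

theory Defs
  imports "HOL-Analysis.Analysis"
begin

text \<open>
  The topological dual is the type of bounded linear maps into the reals with the operator norm.
  The library predicate \<^const>\<open>cone\<close> is closure under scaling by nonnegative factors; it also
  admits the empty set, the trivial cone and the whole space, which the next definition excludes.
\<close>

definition proper_cone :: "'a::real_normed_vector set \<Rightarrow> bool" where
  "proper_cone C \<longleftrightarrow> cone C \<and> {0} \<subset> C \<and> C \<subset> UNIV"

definition closed_cone :: "'a::real_normed_vector set \<Rightarrow> bool" where
  "closed_cone C \<longleftrightarrow> proper_cone C \<and> closed C"

definition pointed :: "'a::real_normed_vector set \<Rightarrow> bool" where
  "pointed C \<longleftrightarrow> C \<inter> uminus ` C = {0}"

definition cone_of :: "'a::real_normed_vector set \<Rightarrow> 'a set" where
  "cone_of A = {t *\<^sub>R a | t a. 0 \<le> t \<and> a \<in> A}"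

definition norming_pair :: "'a::real_normed_vector \<Rightarrow> ('a \<Rightarrow>\<^sub>L real) \<Rightarrow> bool" where
  "norming_pair u f \<longleftrightarrow> u \<in> sphere 0 1 \<and> f \<in> sphere 0 1 \<and> blinfun_apply f u = 1"

definition Q_map :: "'a::real_normed_vector \<Rightarrow> ('a \<Rightarrow>\<^sub>L real) \<Rightarrow> 'a \<Rightarrow> 'a" where
  "Q_map u f x = x - blinfun_apply f x *\<^sub>R u"

definition positively_homogeneous :: "('a::real_normed_vector \<Rightarrow> real) \<Rightarrow> bool" where
  "positively_homogeneous \<phi> \<longleftrightarrow> (\<forall>t\<ge>0. \<forall>x. \<phi> (t *\<^sub>R x) = t * \<phi> x)"

definition subadditive_map :: "('a::real_normed_vector \<Rightarrow> real) \<Rightarrow> bool" where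
  "subadditive_map p \<longleftrightarrow> (\<forall>x y. p (x + y) \<le> p x + p y)"

definition superlinear :: "('a::real_normed_vector \<Rightarrow> real) \<Rightarrow> bool" where
  "superlinear \<phi> \<longleftrightarrow> positively_homogeneous \<phi> \<and> (\<forall>x y. \<phi> (x + y) \<ge> \<phi> x + \<phi> y)"

definition transversally_coercive ::
  "('a::real_normed_vector \<Rightarrow> real) \<Rightarrow> 'a \<Rightarrow> ('a \<Rightarrow>\<^sub>L real) \<Rightarrow> real \<Rightarrow> bool" where
  "transversally_coercive D u f c \<longleftrightarrow>
     (\<forall>x. 0 \<le> D x) \<and> continuous_on UNIV D \<and> positively_homogeneous D \<and>
     0 < c \<and> D u = 0 \<and> (\<forall>x. blinfun_apply f x \<ge> 0 \<longrightarrow> D x \<ge> c * norm (Q_map u f x))"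

definition adapted_defining_function ::
  "('a::real_normed_vector \<Rightarrow> real) \<Rightarrow> 'a set \<Rightarrow> 'a \<Rightarrow> bool" where
  "adapted_defining_function \<phi> C u \<longleftrightarrow>
     closed_cone C \<and> u \<in> sphere 0 1 \<inter> interior C \<and>
     continuous_on UNIV \<phi> \<and> positively_homogeneous \<phi> \<and>
     C = {x. \<phi> x \<ge> 0} \<and> \<phi> u = 1 \<and> (\<forall>x. \<phi> x \<le> norm x)"

definition phi_a ::
  "('a::real_normed_vector \<Rightarrow> real) \<Rightarrow> ('a \<Rightarrow>\<^sub>L real) \<Rightarrow> real \<Rightarrow> 'a \<Rightarrow> real" where
  "phi_a D f \<delta> x = blinfun_apply f x - inverse \<delta> * D x"

definition C_a ::
  "('a::real_normed_vector \<Rightarrow> real) \<Rightarrow> ('a \<Rightarrow>\<^sub>L real) \<Rightarrow> real \<Rightarrow> 'a set" where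
  "C_a D f \<delta> = {x. phi_a D f \<delta> x \<ge> 0}"

definition phi_n ::
  "('a::real_normed_vector \<Rightarrow> real) \<Rightarrow> ('a \<Rightarrow>\<^sub>L real) \<Rightarrow> real \<Rightarrow> 'a \<Rightarrow> real" where
  "phi_n D f r x = min (blinfun_apply f x) (norm x - inverse r * D x)"

definition C_n ::
  "('a::real_normed_vector \<Rightarrow> real) \<Rightarrow> ('a \<Rightarrow>\<^sub>L real) \<Rightarrow> real \<Rightarrow> 'a set" where
  "C_n D f r = {x. phi_n D f r x \<ge> 0}"

end

theory Submission
  imports Defs
begin

text \<open>
  Both defining functions are continuous, positively homogeneous, equal to 1 at \<open>u\<close> and dominated
  by \<open>f\<close>; these properties alone make the superlevel set a closed cone with \<open>u\<close> in its interior and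
  the function adapted to it. The inclusion in the cone over \<open>cball u \<epsilon>\<close> amounts to
  \<open>\<parallel>Q x\<parallel> \<le> \<epsilon> f x\<close>, which coercivity turns into an inequality between scalars; in the case of
  \<open>phi_n\<close> one bounds \<open>\<parallel>x\<parallel> \<le> f x + \<parallel>Q x\<parallel>\<close> first. Pointedness follows from the inclusion, as
  \<open>f \<ge> 1 - \<epsilon> > 0\<close> on \<open>cball u \<epsilon>\<close>.
\<close>

section \<open>Superlevel sets of functions dominated by a norming functional\<close>

lemma norming_pair_apply_le_norm:
  assumes "norming_pair u f"
  shows "blinfun_apply f x \<le> norm x"
proof -
  have "norm (blinfun_apply f x) \<le> norm f * norm x"
    by (rule norm_blinfun)
  then show ?thesis
    using assms by (simp add: norming_pair_def)
qed

text \<open>Domination by \<open>f\<close> serves twice: it makes \<open>\<phi>\<close> negative at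
  \<open>- u\<close>, so the superlevel set is not the whole space, and it yields the bound by the
  norm because \<open>f\<close> has norm 1. The value 1 at \<open>u\<close> makes the cone
  nontrivial.\<close>

lemma adapted_defining_function_superlevel_set:
  assumes np: "norming_pair u f"
    and cont: "continuous_on UNIV \<phi>"
    and hom: "positively_homogeneous \<phi>"
    and u: "\<phi> u = 1"
    and le: "\<And>x. \<phi> x \<le> blinfun_apply f x"
  shows "adapted_defining_function \<phi> {x. 0 \<le> \<phi> x} u"
proof -
  have nu: "norm u = 1" and fu: "blinfun_apply f u = 1"
    using np by (auto simp: norming_pair_def)
  have zero: "\<phi> 0 = 0"
    using hom[unfolded positively_homogeneous_def, rule_format, of 0 0] by simp
  have "\<phi> (- u) < 0"
    using le[of "- u"] fu by (simp add: blinfun.minus_right)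
  then have "- u \<notin> {x. 0 \<le> \<phi> x}"
    by simp
  moreover have "u \<in> {x. 0 \<le> \<phi> x}" "u \<noteq> 0"
    using u nu by auto
  moreover have "cone {x. 0 \<le> \<phi> x}"
    using hom by (simp add: cone_def positively_homogeneous_def)
  moreover have "0 \<in> {x. 0 \<le> \<phi> x}"
    using zero by simp
  ultimately have "proper_cone {x. 0 \<le> \<phi> x}"
    unfolding proper_cone_def by blast
  moreover have "closed {x. 0 \<le> \<phi> x}"
    using cont by (intro closed_Collect_le) auto
  moreover have "u \<in> interior {x. 0 \<le> \<phi> x}"
  proof (rule interiorI)
    \<comment> \<open>The strict superlevel set is an open neighbourhood of \<open>u\<close> inside
      the cone.\<close>
    show "open {x. 0 < \<phi> x}"
      using cont by (intro open_Collect_less) auto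
  qed (use u in auto)
  moreover have "\<phi> x \<le> norm x" for x
    using le[of x] norming_pair_apply_le_norm[OF np, of x] by linarith
  ultimately show ?thesis
    using cont hom u nu by (simp add: adapted_defining_function_def closed_cone_def)
qed

section \<open>Cones over balls about \<open>u\<close>\<close>

lemma in_cone_of_cball_if_Q_map_le:
  assumes "0 \<le> blinfun_apply f x"
    and Q: "norm (Q_map u f x) \<le> \<epsilon> * blinfun_apply f x"
    and "0 \<le> \<epsilon>"
  shows "x \<in> cone_of (cball u \<epsilon>)"
proof (cases "blinfun_apply f x = 0")
  case True
  \<comment> \<open>The hypothesis forces \<open>Q_map u f x = 0\<close>, hence
    \<open>x = 0\<close>; the vertex is represented by the scaling factor 0 and the centre of the
    ball.\<close>
  then have "x = 0 *\<^sub>R u"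
    using Q by (simp add: Q_map_def)
  moreover have "u \<in> cball u \<epsilon>"
    using \<open>0 \<le> \<epsilon>\<close> by simp
  ultimately show ?thesis
    unfolding cone_of_def by blast
next
  case False
  define t where "t = blinfun_apply f x"
  have t: "t > 0"
    using False assms(1) by (simp add: t_def)
  \<comment> \<open>Rescaling moves \<open>x\<close> to the hyperplane where \<open>f\<close> equals
    1. There the displacement from \<open>u\<close> is purely transversal.\<close>
  have "inverse t *\<^sub>R x - u = inverse t *\<^sub>R Q_map u f x"
    using t by (simp add: Q_map_def t_def[symmetric] scaleR_diff_right)
  then have "norm (inverse t *\<^sub>R x - u) = norm (Q_map u f x) / t"
    using t by (simp add: divide_inverse mult.commute)
  also have "\<dots> \<le> \<epsilon>"
    using Q t by (simp add: t_def[symmetric] pos_divide_le_eq)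
  finally have "inverse t *\<^sub>R x \<in> cball u \<epsilon>"
    by (simp add: dist_norm norm_minus_commute)
  moreover have "x = t *\<^sub>R (inverse t *\<^sub>R x)"
    using t by simp
  ultimately show ?thesis
    unfolding cone_of_def using t less_imp_le by blast
qed

lemma pointed_if_subset_cone_of_cball:
  assumes np: "norming_pair u f"
    and sub: "C \<subseteq> cone_of (cball u \<epsilon>)"
    and "0 \<in> C" "\<epsilon> < 1"
  shows "pointed C"
proof -
  have pos: "0 < blinfun_apply f a" if "a \<in> cball u \<epsilon>" for a
  proof -
    \<comment> \<open>The left side is \<open>1 - f a\<close> and the right side is at most
      \<open>\<epsilon>\<close>.\<close>
    have "blinfun_apply f (u - a) \<le> norm (u - a)"
      by (rule norming_pair_apply_le_norm[OF np])
    with that np \<open>\<epsilon> < 1\<close> show ?thesis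
      by (simp add: blinfun.diff_right norming_pair_def dist_norm)
  qed
  have "x = 0" if "x \<in> C" "- x \<in> C" for x
  proof -
    from that sub have "x \<in> cone_of (cball u \<epsilon>)" "- x \<in> cone_of (cball u \<epsilon>)"
      by auto
    then obtain t a s b where
      t: "0 \<le> t" "a \<in> cball u \<epsilon>" "x = t *\<^sub>R a" and
      s: "0 \<le> s" "b \<in> cball u \<epsilon>" "- x = s *\<^sub>R b"
      unfolding cone_of_def by blast
    \<comment> \<open>The representation of \<open>- x\<close> gives \<open>f x \<le> 0\<close>,
      that of \<open>x\<close> gives \<open>f x = t * f a\<close> with \<open>f a > 0\<close>; only
      \<open>t = 0\<close> remains.\<close>
    have "blinfun_apply f (- x) = s * blinfun_apply f b"
      unfolding s(3) by (simp add: blinfun.scaleR_right)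
    then have "0 \<le> - blinfun_apply f x"
      using pos[OF s(2)] s(1) by (simp add: blinfun.minus_right)
    then have "t * blinfun_apply f a \<le> 0"
      using t(3) by (simp add: blinfun.scaleR_right)
    then have "t = 0"
      using pos[OF t(2)] t(1) by (simp add: mult_le_0_iff)
    then show "x = 0"
      using t(3) by simp
  qed
  then show ?thesis
    unfolding pointed_def using \<open>0 \<in> C\<close> by (auto simp: image_iff)
qed

lemma adapted_defining_function_zero_in:
  assumes "adapted_defining_function \<phi> C u"
  shows "0 \<in> C"
  using assms by (auto simp: adapted_defining_function_def closed_cone_def proper_cone_def)

section \<open>Adaptedness of the two defining functions\<close>

lemma positively_homogeneous_phi_a:
  assumes "positively_homogeneous D"
  shows "positively_homogeneous (phi_a D f \<delta>)"
  using assms by (simp add: positively_homogeneous_def phi_a_def blinfun.scaleR_right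
      algebra_simps)

text \<open>Nonnegativity of \<open>D\<close> gives the domination by \<open>f\<close>, and
  \<open>D u = 0\<close> gives the value 1 at \<open>u\<close>.\<close>

lemma adapted_defining_function_phi_a:
  assumes np: "norming_pair u f" and tc: "transversally_coercive D u f c" and "0 < \<delta>"
  shows "adapted_defining_function (phi_a D f \<delta>) (C_a D f \<delta>) u"
  unfolding C_a_def
proof (rule adapted_defining_function_superlevel_set[OF np])
  show "continuous_on UNIV (phi_a D f \<delta>)"
    using tc unfolding phi_a_def transversally_coercive_def by (intro continuous_intros) auto
  show "positively_homogeneous (phi_a D f \<delta>)"
    using tc by (intro positively_homogeneous_phi_a) (simp add: transversally_coercive_def)
  show "phi_a D f \<delta> u = 1"
    using np tc by (simp add: phi_a_def norming_pair_def transversally_coercive_def)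
  show "phi_a D f \<delta> x \<le> blinfun_apply f x" for x
    using tc \<open>0 < \<delta>\<close> by (simp add: phi_a_def transversally_coercive_def)
qed

text \<open>Having \<open>f\<close> as one entry of the minimum gives the domination by
  \<open>f\<close>. At \<open>u\<close> both entries equal 1, and a nonnegative factor can be pulled
  out of the minimum.\<close>

lemma adapted_defining_function_phi_n:
  assumes np: "norming_pair u f" and tc: "transversally_coercive D u f c"
  shows "adapted_defining_function (phi_n D f r) (C_n D f r) u"
  unfolding C_n_def
proof (rule adapted_defining_function_superlevel_set[OF np])
  show "continuous_on UNIV (phi_n D f r)"
    using tc unfolding phi_n_def transversally_coercive_def by (intro continuous_intros) auto
  show "positively_homogeneous (phi_n D f r)"
    unfolding positively_homogeneous_def
  proof (intro allI impI)
    fix t :: real and x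
    assume "0 \<le> t"
    then have "D (t *\<^sub>R x) = t * D x"
      using tc by (simp add: transversally_coercive_def positively_homogeneous_def)
    then have "phi_n D f r (t *\<^sub>R x)
        = min (t * blinfun_apply f x) (t * (norm x - inverse r * D x))"
      using \<open>0 \<le> t\<close> by (simp add: phi_n_def blinfun.scaleR_right algebra_simps)
    also have "\<dots> = t * phi_n D f r x"
      using \<open>0 \<le> t\<close> by (simp add: phi_n_def min_mult_distrib_left)
    finally show "phi_n D f r (t *\<^sub>R x) = t * phi_n D f r x" .
  qed
  show "phi_n D f r u = 1"
    using np tc by (simp add: phi_n_def norming_pair_def transversally_coercive_def)
  show "phi_n D f r x \<le> blinfun_apply f x" for x
    by (simp add: phi_n_def)
qed

section \<open>Inclusion in the cone over a ball\<close>

lemma C_a_subset_cone_of_cball: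
  assumes tc: "transversally_coercive D u f c"
    and \<delta>: "0 < \<delta>" "\<delta> < c * \<epsilon>" and "0 < \<epsilon>"
  shows "C_a D f \<delta> \<subseteq> cone_of (cball u \<epsilon>)"
proof
  fix x
  assume "x \<in> C_a D f \<delta>"
  then have D: "D x \<le> \<delta> * blinfun_apply f x"
    using \<delta>(1) by (simp add: C_a_def phi_a_def field_simps)
  have "0 \<le> D x" "0 < c"
    using tc by (auto simp: transversally_coercive_def)
  \<comment> \<open>Coercivity is available only where \<open>f\<close> is nonnegative. A negative
    \<open>f x\<close> would make \<open>D x\<close> negative.\<close>
  with D \<delta>(1) have f: "0 \<le> blinfun_apply f x"
    by (smt (verit) mult_pos_neg)
  then have "c * norm (Q_map u f x) \<le> D x"
    using tc by (simp add: transversally_coercive_def)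
  also note D
  also have "\<delta> * blinfun_apply f x \<le> c * (\<epsilon> * blinfun_apply f x)"
    using mult_right_mono[OF less_imp_le[OF \<delta>(2)] f] by (simp add: mult.assoc)
  finally have "norm (Q_map u f x) \<le> \<epsilon> * blinfun_apply f x"
    using \<open>0 < c\<close> by simp
  then show "x \<in> cone_of (cball u \<epsilon>)"
    using f \<open>0 < \<epsilon>\<close> by (intro in_cone_of_cball_if_Q_map_le) auto
qed

text \<open>With \<open>q\<close> the norm of the transversal part, membership and coercivity give
  \<open>(c - r) * q \<le> r * f x\<close>. The threshold on \<open>r\<close> is the value at which
  \<open>r / (c - r)\<close> equals \<open>\<epsilon>\<close>.\<close>

lemma C_n_subset_cone_of_cball:
  assumes np: "norming_pair u f" and tc: "transversally_coercive D u f c"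
    and r: "0 < r" "r < c * \<epsilon> / (1 + \<epsilon>)" and "0 < \<epsilon>"
  shows "C_n D f r \<subseteq> cone_of (cball u \<epsilon>)"
proof
  fix x
  assume "x \<in> C_n D f r"
  then have f: "0 \<le> blinfun_apply f x" and D: "D x \<le> r * norm x"
    using r(1) by (auto simp: C_n_def phi_n_def field_simps)
  define q where "q = norm (Q_map u f x)"
  have "0 < c" and "c * q \<le> D x"
    using tc f by (auto simp: transversally_coercive_def q_def)
  have "x = blinfun_apply f x *\<^sub>R u + Q_map u f x"
    by (simp add: Q_map_def)
  then have "norm x \<le> norm (blinfun_apply f x *\<^sub>R u) + q"
    unfolding q_def by (metis norm_triangle_ineq)
  then have nx: "norm x \<le> blinfun_apply f x + q"
    using f np by (simp add: norming_pair_def)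
  have r': "r * (1 + \<epsilon>) \<le> c * \<epsilon>"
    using r(2) \<open>0 < \<epsilon>\<close> by (simp add: pos_less_divide_eq)
  have "c * q \<le> r * (blinfun_apply f x + q)"
    using \<open>c * q \<le> D x\<close> D mult_left_mono[OF nx, of r] r(1) by linarith
  \<comment> \<open>Multiplying by \<open>1 + \<epsilon>\<close> brings in the bound
    \<open>r'\<close>; afterwards \<open>c * \<epsilon> * q\<close> occurs on both sides and
    cancels.\<close>
  then have "c * q * (1 + \<epsilon>) \<le> r * (blinfun_apply f x + q) * (1 + \<epsilon>)"
    using \<open>0 < \<epsilon>\<close> by (intro mult_right_mono) auto
  also have "\<dots> = r * (1 + \<epsilon>) * (blinfun_apply f x + q)"
    by (simp add: ac_simps)
  also have "\<dots> \<le> c * \<epsilon> * (blinfun_apply f x + q)"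
    using f by (intro mult_right_mono[OF r']) (simp add: q_def)
  finally have "c * q \<le> c * (\<epsilon> * blinfun_apply f x)"
    by (simp add: algebra_simps)
  then have "q \<le> \<epsilon> * blinfun_apply f x"
    using \<open>0 < c\<close> by simp
  then show "x \<in> cone_of (cball u \<epsilon>)"
    using f \<open>0 < \<epsilon>\<close> by (intro in_cone_of_cball_if_Q_map_le) (auto simp: q_def)
qed

section \<open>Superlinearity and convexity\<close>

lemma superlinear_phi_a:
  assumes "positively_homogeneous D" "subadditive_map D" "0 < \<delta>"
  shows "superlinear (phi_a D f \<delta>)"
  unfolding superlinear_def
proof (intro conjI allI)
  show "positively_homogeneous (phi_a D f \<delta>)"
    using assms(1) by (rule positively_homogeneous_phi_a)
  fix x y
  \<comment> \<open>The minus sign in \<open>phi_a\<close> turns this into superadditivity, since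
    \<open>f\<close> is additive.\<close>
  have "inverse \<delta> * D (x + y) \<le> inverse \<delta> * (D x + D y)"
    using assms by (intro mult_left_mono) (auto simp: subadditive_map_def)
  then show "phi_a D f \<delta> x + phi_a D f \<delta> y \<le> phi_a D f \<delta> (x + y)"
    by (simp add: phi_a_def blinfun.add_right algebra_simps)
qed

text \<open>Superlinear functions are concave, and concave functions have convex superlevel
  sets.\<close>

lemma convex_superlinear_superlevel_set:
  assumes "superlinear \<phi>"
  shows "convex {x. 0 \<le> \<phi> x}"
proof (rule convexI)
  fix x y and s t :: real
  assume "x \<in> {x. 0 \<le> \<phi> x}" "y \<in> {x. 0 \<le> \<phi> x}" "0 \<le> s" "0 \<le> t"
  then have "0 \<le> s * \<phi> x + t * \<phi> y"
    by simp
  also have "\<dots> = \<phi> (s *\<^sub>R x) + \<phi> (t *\<^sub>R y)"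
    using assms \<open>0 \<le> s\<close> \<open>0 \<le> t\<close> by (simp add: superlinear_def positively_homogeneous_def)
  also have "\<dots> \<le> \<phi> (s *\<^sub>R x + t *\<^sub>R y)"
    using assms by (simp add: superlinear_def)
  finally show "s *\<^sub>R x + t *\<^sub>R y \<in> {x. 0 \<le> \<phi> x}"
    by simp
qed

theorem theorem5p5:
  fixes u :: "'a::real_normed_vector"
    and f :: "'a \<Rightarrow>\<^sub>L real"
    and D :: "'a \<Rightarrow> real"
    and c :: real
  assumes "norming_pair u f"
    and "transversally_coercive D u f c"
  shows "(\<forall>\<delta>>0.
            closed_cone (C_a D f \<delta>) \<and>
            u \<in> interior (C_a D f \<delta>) \<and>
            (\<forall>\<epsilon>. 0 < \<epsilon> \<and> \<epsilon> < 1 \<and> \<delta> < c * \<epsilon> \<longrightarrow>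
               C_a D f \<delta> \<subseteq> cone_of (cball u \<epsilon>) \<and>
               pointed (C_a D f \<delta>) \<and>
               adapted_defining_function (phi_a D f \<delta>) (C_a D f \<delta>) u) \<and>
            (subadditive_map D \<longrightarrow>
               superlinear (phi_a D f \<delta>) \<and> convex (C_a D f \<delta>))) \<and>
         (\<forall>r>0.
            closed_cone (C_n D f r) \<and>
            u \<in> interior (C_n D f r) \<and>
            (\<forall>\<epsilon>. 0 < \<epsilon> \<and> \<epsilon> < 1 \<and> r < c * \<epsilon> / (1 + \<epsilon>) \<longrightarrow>
               C_n D f r \<subseteq> cone_of (cball u \<epsilon>) \<and>
               pointed (C_n D f r) \<and>
               adapted_defining_function (phi_n D f r) (C_n D f r) u))"
proof (intro conjI allI impI; (elim conjE)?)
  fix \<delta> :: real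
  assume \<delta>: "0 < \<delta>"
  \<comment> \<open>Adaptedness includes that the set is a closed cone with \<open>u\<close> in its
    interior, so both claims are read off from it.\<close>
  note adapted = adapted_defining_function_phi_a[OF assms \<delta>]
  show "closed_cone (C_a D f \<delta>)" "u \<in> interior (C_a D f \<delta>)"
    using adapted by (auto simp: adapted_defining_function_def)
  show "adapted_defining_function (phi_a D f \<delta>) (C_a D f \<delta>) u"
    by (fact adapted)
  show sub: "C_a D f \<delta> \<subseteq> cone_of (cball u \<epsilon>)" if "0 < \<epsilon>" "\<delta> < c * \<epsilon>" for \<epsilon>
    using C_a_subset_cone_of_cball[OF assms(2) \<delta> that(2,1)] .
  show "pointed (C_a D f \<delta>)" if "0 < \<epsilon>" "\<epsilon> < 1" "\<delta> < c * \<epsilon>" for \<epsilon>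
    using pointed_if_subset_cone_of_cball[OF assms(1) sub[OF that(1,3)]
        adapted_defining_function_zero_in[OF adapted] that(2)] .
  show superl: "superlinear (phi_a D f \<delta>)" if "subadditive_map D"
    using superlinear_phi_a[OF _ that \<delta>] assms(2) by (simp add: transversally_coercive_def)
  show "convex (C_a D f \<delta>)" if "subadditive_map D"
    unfolding C_a_def by (rule convex_superlinear_superlevel_set[OF superl[OF that]])
next
  fix r :: real
  assume r: "0 < r"
  note adapted = adapted_defining_function_phi_n[OF assms, of r]
  show "closed_cone (C_n D f r)" "u \<in> interior (C_n D f r)"
    using adapted by (auto simp: adapted_defining_function_def)
  show "adapted_defining_function (phi_n D f r) (C_n D f r) u"
    by (fact adapted)
  show sub: "C_n D f r \<subseteq> cone_of (cball u \<epsilon>)" if "0 < \<epsilon>" "r < c * \<epsilon> / (1 + \<epsilon>)" for \<epsilon>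
    using C_n_subset_cone_of_cball[OF assms r that(2,1)] .
  show "pointed (C_n D f r)" if "0 < \<epsilon>" "\<epsilon> < 1" "r < c * \<epsilon> / (1 + \<epsilon>)" for \<epsilon>
    using pointed_if_subset_cone_of_cball[OF assms(1) sub[OF that(1,3)]
        adapted_defining_function_zero_in[OF adapted] that(2)] .
qed

end
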